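(* If the speed ratio $\alpha$ of the two robots is controlled by an oblivious adversary (and unknown to the algorithm), then, even with zero wait time and zero computation delay, it is improbable for the two robots to gather: for any randomized algorithm, the probability of gathering is zero.
   Context: Two robots are anonymous, oblivious (no memory of past cycles), silent (no communication) points in the Euclidean plane with no common coordinate system, each having access to random bits. Each robot repeatedly executes a cycle: it waits (wait time $\mathcal{W}$), looks (obtains a snapshot of the other robot's current position, which may be in motion), has a computation delay $\mathcal{C}$, then moves at its speed to a destination computed from the snapshot and its random bits, reaching it in the same cycle (rigid movement). By the reduction to the line, an algorithm is described by the fact that at each cycle a robot moves a distance $\lambda\delta$ towards the other robot along the line joining them, where $\delta$ is the observed distance and $\lambda\in\mathbb{R}$ is chosen by the algorithm (possibly at random). A robot that looks and finds the other robot at its own position decides it has gathered and stops; gathering means both robots are at the same point. An oblivious adversary knows the algorithm but not the outcomes of random bits. Here all wait times and computation delays are $0$, and the adversary chooses the speed ratio $\alpha\in(0,\infty)$ of the robots, which the algorithm does not know. "Improbable" means the probability of gathering is zero (although the set of gathering outcomes may be nonempty). *)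

theory Defs
  imports "HOL-Probability.Probability"
begin

text \<open>Line model (after the reduction to the line) with zero wait time and zero
computation delay.  Each robot's state records its current move: it left position
src at time tstart towards dst, arriving at time tend (rigid movement, constant
speed); cnt is the number of random choices consumed; stopped says that it has
decided it has gathered.\<close>

record rstate =
  src :: real
  dst :: real
  tstart :: real
  tend :: real
  cnt :: nat
  stopped :: bool

text \<open>Position of a robot at time t (t is never earlier than tstart when used).\<close>
definition pos_at :: "rstate \<Rightarrow> real \<Rightarrow> real" where
  "pos_at r t = (if stopped r \<or> tend r \<le> tstart r \<or> tend r \<le> t then dst r
     else src r + (dst r - src r) * ((t - tstart r) / (tend r - tstart r)))"

definition look_move :: "real \<Rightarrow> (nat \<Rightarrow> real) \<Rightarrow> rstate \<Rightarrow> rstate \<Rightarrow> rstate" where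
  "look_move v L r r2 =
     (let t = tend r; x = dst r; y = pos_at r2 t in
      if y = x then r\<lparr>src := x, stopped := True\<rparr>
      else (let d = x + L (cnt r) * (y - x) in
            \<lparr>src = x, dst = d, tstart = t, tend = t + \<bar>d - x\<bar> / v,
             cnt = Suc (cnt r), stopped = False\<rparr>))"

definition gstep :: "real \<Rightarrow> (bool \<times> nat \<Rightarrow> real) \<Rightarrow> rstate \<times> rstate \<Rightarrow> rstate \<times> rstate" where
  "gstep \<alpha> \<omega> s = (case s of (r1, r2) \<Rightarrow>
     if stopped r1 \<and> stopped r2 then (r1, r2)
     else if \<not> stopped r1 \<and> (stopped r2 \<or> tend r1 \<le> tend r2)
       then (look_move 1 (\<lambda>k. \<omega> (True, k)) r1 r2, r2)
       else (r1, look_move \<alpha> (\<lambda>k. \<omega> (False, k)) r2 r1))"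

definition init_state :: "real \<Rightarrow> rstate" where
  "init_state p = \<lparr>src = p, dst = p, tstart = 0, tend = 0, cnt = 0, stopped = False\<rparr>"

definition run :: "real \<Rightarrow> real \<Rightarrow> real \<Rightarrow> (bool \<times> nat \<Rightarrow> real) \<Rightarrow> nat \<Rightarrow> rstate \<times> rstate" where
  "run \<alpha> p q \<omega> n = (gstep \<alpha> \<omega> ^^ n) (init_state p, init_state q)"

text \<open>Gathering: at some point both robots have stopped (then they are at the same point).\<close>
definition gathers :: "real \<Rightarrow> real \<Rightarrow> real \<Rightarrow> (bool \<times> nat \<Rightarrow> real) \<Rightarrow> bool" where
  "gathers \<alpha> p q \<omega> = (\<exists>n. stopped (fst (run \<alpha> p q \<omega> n)) \<and> stopped (snd (run \<alpha> p q \<omega> n)))"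

definition outcomes :: "real measure \<Rightarrow> (bool \<times> nat \<Rightarrow> real) measure" where
  "outcomes D = PiM UNIV (\<lambda>_. D)"

end

theory Submission
  imports Defs "HOL-Library.Landau_Symbols"
begin

text \<open>By similarity the robots may be assumed to start at 0 and 1, and by Fubini it suffices that, for
each fixed sequence \<open>\<omega>\<close> of random choices, only countably many speed ratios \<open>\<alpha>\<close> lead to gathering.
As long as nobody has stopped, the positions and travelled distances after \<open>n\<close> steps are, for each
of the finitely many choices of who looks next and of the directions of motion, Laurent polynomials
in \<open>\<alpha>\<close>. The observed signed distance between the robots never vanishes identically: while robot 1
travels a distance \<open>L\<close>, robot 2 travels \<open>\<alpha> L\<close>, so each nonzero move of robot 1 raises by exactly one
the degree in \<open>\<alpha>\<close> of the distance it observes next, whereas an observation by robot 2 does not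
raise any degree. Exchanging the robots replaces \<open>\<alpha>\<close> by \<open>1 / \<alpha>\<close>. Hence each step excludes only
finitely many \<open>\<alpha>\<close>.\<close>

subsection \<open>Laurent polynomials on the positive reals\<close>

text \<open>Only positive arguments count, as speed ratios are positive. Clearing the denominator by
  a power of \<open>a\<close> turns zeros into roots of a polynomial.\<close>

definition laurent :: "(real \<Rightarrow> real) \<Rightarrow> bool" where
  "laurent g \<longleftrightarrow> (\<exists>m P. \<forall>a>0. g a * a ^ m = poly P a)"

lemma laurent_const [simp, intro]: "laurent (\<lambda>_. c)"
  unfolding laurent_def by (rule exI[of _ 0], rule exI[of _ "[:c:]"]) simp

lemma laurent_add [intro]:
  assumes "laurent f" "laurent g"
  shows "laurent (\<lambda>a. f a + g a)"
proof -
  from assms obtain m P n Q where *: "\<And>a. a > 0 \<Longrightarrow> f a * a ^ m = poly P a"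
    "\<And>a. a > 0 \<Longrightarrow> g a * a ^ n = poly Q a"
    unfolding laurent_def by blast
  have "(f a + g a) * a ^ (m + n) = poly (P * monom 1 n + Q * monom 1 m) a" if "a > 0" for a
    using *[OF that, symmetric] by (simp add: poly_monom power_add algebra_simps)
  then show ?thesis unfolding laurent_def by blast
qed

lemma laurent_mult [intro]:
  assumes "laurent f" "laurent g"
  shows "laurent (\<lambda>a. f a * g a)"
proof -
  from assms obtain m P n Q where *: "\<And>a. a > 0 \<Longrightarrow> f a * a ^ m = poly P a"
    "\<And>a. a > 0 \<Longrightarrow> g a * a ^ n = poly Q a"
    unfolding laurent_def by blast
  have "(f a * g a) * a ^ (m + n) = poly (P * Q) a" if "a > 0" for a
    using *[OF that, symmetric] by (simp add: power_add algebra_simps)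
  then show ?thesis unfolding laurent_def by blast
qed

lemma laurent_diff [intro]:
  assumes "laurent f" "laurent g"
  shows "laurent (\<lambda>a. f a - g a)"
  using laurent_add[OF assms(1) laurent_mult[OF laurent_const[of "-1"] assms(2)]] by simp

lemma laurent_ident: "laurent (\<lambda>a. a)"
  unfolding laurent_def by (rule exI[of _ 0], rule exI[of _ "[:0, 1:]"]) simp

lemma laurent_inverse: "laurent (\<lambda>a. 1 / a)"
  unfolding laurent_def by (rule exI[of _ 1], rule exI[of _ "1"]) simp

text \<open>The polynomial obtained by clearing the denominator is nonzero because \<open>g\<close>
  does not vanish at the given positive point, so it has finitely many roots.\<close>

lemma laurent_finite_zeros:
  assumes "laurent g" "a > 0" "g a \<noteq> 0"
  shows "finite {a. a > 0 \<and> g a = 0}"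
proof -
  from assms obtain m P where *: "\<And>a. a > 0 \<Longrightarrow> g a * a ^ m = poly P a"
    unfolding laurent_def by blast
  from *[OF assms(2)] assms have "P \<noteq> 0" by auto
  then have "finite {a. poly P a = 0}" by (rule poly_roots_finite)
  moreover have "{a. a > 0 \<and> g a = 0} \<subseteq> {a. poly P a = 0}" using * by force
  ultimately show ?thesis by (rule finite_subset[rotated])
qed

subsection \<open>Formal states and the growth of the observed distance\<close>

text \<open>Robots are indexed as in the random choices: \<open>True\<close> is robot 1, whose speed
  is the unit, and \<open>False\<close> is robot 2.\<close>

definition speed :: "bool \<Rightarrow> real \<Rightarrow> real" where
  "speed b a = (if b then 1 else a)"

text \<open>The distance that the other robot covers while robot \<open>b\<close> covers a unit
  distance.\<close>

definition ratio :: "bool \<Rightarrow> real \<Rightarrow> real" where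
  "ratio b a = speed (\<not> b) a / speed b a"

text \<open>The limit in which \<open>ratio b\<close> tends to infinity; orders of growth along this
  filter serve as degrees in \<open>ratio b\<close>.\<close>

definition regime :: "bool \<Rightarrow> real filter" where
  "regime b = (if b then at_top else at_right 0)"

lemma speed_pos: "a > 0 \<Longrightarrow> speed b a > 0"
  by (simp add: speed_def)

lemma laurent_ratio: "laurent (ratio b)"
  by (cases b) (auto simp: ratio_def[abs_def] speed_def laurent_ident laurent_inverse)

lemma regime_pos: "eventually (\<lambda>a. a > 0) (regime b)"
  by (cases b) (auto simp: regime_def eventually_gt_at_top eventually_at_right_less)

lemma regime_nontrivial: "regime b \<noteq> bot"
  by (cases b) (auto simp: regime_def)

lemma ratio_at_top: "filterlim (ratio b) at_top (regime b)"
  by (cases b) (auto simp: ratio_def[abs_def] speed_def regime_def filterlim_ident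
      filterlim_inverse_at_top_right inverse_eq_divide[symmetric])

lemma ratio_other: "a > 0 \<Longrightarrow> ratio (\<not> b) a = 1 / ratio b a"
  by (simp add: ratio_def)

lemma one_smallo_ratio: "(\<lambda>_. 1) \<in> o[regime b](ratio b)"
  using filterlim_at_top_imp_at_infinity[OF ratio_at_top[of b]]
  by (simp add: smallomega_iff_smallo[symmetric] smallomega_1_conv_filterlim)

lemma ratio_other_bigo: "ratio (\<not> b) \<in> O[regime b](\<lambda>_. 1)"
proof -
  have "eventually (\<lambda>a. ratio b a \<ge> 1) (regime b)"
    using ratio_at_top[of b] by (simp add: filterlim_at_top)
  then have "eventually (\<lambda>a. norm (ratio (\<not> b) a) \<le> 1 * norm (1::real)) (regime b)"
    using regime_pos[of b] by eventually_elim (simp add: ratio_other divide_simps)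
  then show ?thesis by (rule bigoI)
qed

text \<open>\<open>fbeg\<close> and \<open>fend\<close> are the distances travelled up to the start and the end of the move; dividing
them by the speed gives the times \<open>tstart\<close> and \<open>tend\<close>.\<close>
record frobot =
  fsrc :: "real \<Rightarrow> real"
  fdst :: "real \<Rightarrow> real"
  fbeg :: "real \<Rightarrow> real"
  fend :: "real \<Rightarrow> real"
  fcnt :: nat

type_synonym fstate = "bool \<Rightarrow> frobot"

text \<open>The sign \<open>\<sigma>\<close> is the direction in which the observed robot is moving, and in \<open>fmove\<close> the sign
\<open>\<tau>\<close> stands for that of the new displacement; both depend on \<open>\<alpha>\<close> in a real run, so all
combinations are considered.\<close>
definition gap :: "bool \<Rightarrow> real \<Rightarrow> fstate \<Rightarrow> real \<Rightarrow> real" where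
  "gap b \<sigma> s = (\<lambda>a. fsrc (s (\<not> b)) a + \<sigma> * (ratio b a * fend (s b) a - fbeg (s (\<not> b)) a) - fdst (s b) a)"

definition fmove :: "(bool \<times> nat \<Rightarrow> real) \<Rightarrow> bool \<Rightarrow> real \<Rightarrow> real \<Rightarrow> fstate \<Rightarrow> fstate" where
  "fmove \<omega> b \<sigma> \<tau> s = s(b :=
     \<lparr>fsrc = fdst (s b),
      fdst = (\<lambda>a. fdst (s b) a + \<omega> (b, fcnt (s b)) * gap b \<sigma> s a),
      fbeg = fend (s b),
      fend = (\<lambda>a. fend (s b) a + \<tau> * (\<omega> (b, fcnt (s b)) * gap b \<sigma> s a)),
      fcnt = Suc (fcnt (s b))\<rparr>)"

section \<open>Orders of growth of the travelled and observed distances\<close>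

definition comps :: "fstate \<Rightarrow> (real \<Rightarrow> real) set" where
  "comps s = (\<Union>b. {fsrc (s b), fdst (s b), fbeg (s b), fend (s b)})"

lemma comps_ball: "(\<forall>g\<in>comps s. Q g) \<longleftrightarrow>
   (\<forall>b. Q (fsrc (s b)) \<and> Q (fdst (s b)) \<and> Q (fbeg (s b)) \<and> Q (fend (s b)))"
  by (auto simp: comps_def)

text \<open>The total distance travelled by robot \<open>b\<close> has exact order \<open>k\<close>,
  and no component exceeds this order. This is what prevents cancellation in
  \<open>gap b\<close>.\<close>

definition dominant :: "bool \<Rightarrow> nat \<Rightarrow> fstate \<Rightarrow> bool" where
  "dominant b k s \<longleftrightarrow> fend (s b) \<in> \<Theta>[regime b](\<lambda>a. ratio b a ^ k) \<and>
     (\<forall>g\<in>comps s. g \<in> O[regime b](\<lambda>a. ratio b a ^ k))"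

text \<open>Either robot may look next, so the invariant demands dominance of each robot, in its own
  regime and with its own order.\<close>

definition admissible :: "fstate \<Rightarrow> bool" where
  "admissible s \<longleftrightarrow> (\<forall>g\<in>comps s. laurent g) \<and> (\<forall>b. \<exists>k. dominant b k s)"

lemma gap_laurent:
  assumes "\<forall>g\<in>comps s. laurent g"
  shows "laurent (gap b \<sigma> s)"
proof -
  have L: "laurent g" if "g \<in> comps s" for g using assms that by blast
  show ?thesis unfolding gap_def
    by (intro laurent_add laurent_diff laurent_mult laurent_const laurent_ratio L) (auto simp: comps_def)
qed

lemma ratio_pow_smallo: "(\<lambda>a. ratio b a ^ k) \<in> o[regime b](\<lambda>a. ratio b a ^ Suc k)"
  using landau_o.small_big_mult[OF one_smallo_ratio[of b] landau_o.big_refl[of "\<lambda>a. ratio b a ^ k"]]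
  by simp

lemma plus_smallo_bigtheta:
  fixes f g :: "real \<Rightarrow> real"
  assumes "f \<in> o[F](g)"
  shows "(\<lambda>a. f a + g a) \<in> \<Theta>[F](g)"
  using landau_theta.plus_absorb1[OF assms] bigtheta_refl by blast

lemma add_cmult_in_bigo:
  fixes f g h :: "real \<Rightarrow> real"
  assumes "f \<in> O[F](h)" "g \<in> O[F](h)"
  shows "(\<lambda>a. f a + c * g a) \<in> O[F](h)"
  using assms by (cases "c = 0") (auto intro!: sum_in_bigo)

text \<open>The term \<open>\<sigma> * ratio b a * fend (s b) a\<close> has exact order
  \<open>Suc k\<close>, while all other terms have order at most \<open>k\<close> and cannot cancel
  it.\<close>

lemma gap_bigtheta:
  assumes "dominant b k s" "\<sigma> \<noteq> 0"
  shows "gap b \<sigma> s \<in> \<Theta>[regime b](\<lambda>a. ratio b a ^ Suc k)"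
proof -
  let ?r = "\<lambda>a. fsrc (s (\<not> b)) a - \<sigma> * fbeg (s (\<not> b)) a - fdst (s b) a"
  let ?m = "\<lambda>a. \<sigma> * (ratio b a * fend (s b) a)"
  have O: "g \<in> O[regime b](\<lambda>a. ratio b a ^ k)" if "g \<in> comps s" for g
    using assms that by (simp add: dominant_def)
  have "?r \<in> O[regime b](\<lambda>a. ratio b a ^ k)"
    using assms(2) by (intro sum_in_bigo(2) landau_o.big.cmult_in_iff[THEN iffD2] O) (auto simp: comps_def)
  from landau_o.big_small_trans[OF this ratio_pow_smallo]
  have r: "?r \<in> o[regime b](\<lambda>a. ratio b a ^ Suc k)" .
  have m: "?m \<in> \<Theta>[regime b](\<lambda>a. ratio b a ^ Suc k)"
    using assms by (auto simp: dominant_def intro!: landau_theta.mult)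
  have "?r \<in> o[regime b](?m)"
    unfolding landau_o.small.cong_bigtheta[OF m] by (rule r)
  then have "(\<lambda>a. ?r a + ?m a) \<in> \<Theta>[regime b](?m)"
    by (rule plus_smallo_bigtheta)
  also note m
  also have "(\<lambda>a. ?r a + ?m a) = gap b \<sigma> s"
    by (simp add: gap_def algebra_simps fun_eq_iff)
  finally show ?thesis .
qed

text \<open>In \<open>regime b\<close> the factor \<open>ratio (\<not> b)\<close> is bounded, so an
  observation by the other robot does not raise the order.\<close>

lemma gap_bigo_other:
  assumes "dominant b k s"
  shows "gap (\<not> b) \<sigma> s \<in> O[regime b](\<lambda>a. ratio b a ^ k)"
proof -
  have O: "g \<in> O[regime b](\<lambda>a. ratio b a ^ k)" if "g \<in> comps s" for g
    using assms that by (simp add: dominant_def)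
  have "(\<lambda>a. ratio (\<not> b) a * fend (s (\<not> b)) a) \<in> O[regime b](\<lambda>a. 1 * ratio b a ^ k)"
    by (rule landau_o.big.mult[OF ratio_other_bigo O]) (auto simp: comps_def)
  then have "(\<lambda>a. ratio (\<not> b) a * fend (s (\<not> b)) a) \<in> O[regime b](\<lambda>a. ratio b a ^ k)" by simp
  then show ?thesis unfolding gap_def
    by (intro sum_in_bigo(2) add_cmult_in_bigo O[of "fsrc (s _)"] O[of "fbeg (s _)"] O[of "fdst (s _)"])
      (auto simp: comps_def)
qed

text \<open>A zero choice produces no new components, and the order stays. Otherwise the
  displacement has exact order \<open>Suc k\<close> and outweighs the distance travelled
  before.\<close>

lemma fmove_dominant_same:
  assumes "dominant b k s" "\<sigma> \<noteq> 0" "\<tau> \<noteq> 0"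
  shows "\<exists>k. dominant b k (fmove \<omega> b \<sigma> \<tau> s)"
proof (cases "\<omega> (b, fcnt (s b)) = 0")
  case True
  then have "dominant b k (fmove \<omega> b \<sigma> \<tau> s)"
    using assms(1) by (auto simp: dominant_def comps_ball fmove_def)
  then show ?thesis ..
next
  case False
  let ?l = "\<omega> (b, fcnt (s b))"
  have O: "g \<in> o[regime b](\<lambda>a. ratio b a ^ Suc k)" if "g \<in> comps s" for g
    using landau_o.big_small_trans[OF _ ratio_pow_smallo] assms(1) that unfolding dominant_def by blast
  note O' = landau_o.small_imp_big[OF O]
  note G = gap_bigtheta[OF assms(1,2)]
  have G': "gap b \<sigma> s \<in> O[regime b](\<lambda>a. ratio b a ^ Suc k)" using G by blast
  have T: "(\<lambda>a. \<tau> * (?l * gap b \<sigma> s a)) \<in> \<Theta>[regime b](\<lambda>a. ratio b a ^ Suc k)"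
    using G False assms(3) by simp
  have "fend (s b) \<in> o[regime b](\<lambda>a. \<tau> * (?l * gap b \<sigma> s a))"
    unfolding landau_o.small.cong_bigtheta[OF T] by (rule O) (auto simp: comps_def)
  then have "(\<lambda>a. fend (s b) a + \<tau> * (?l * gap b \<sigma> s a)) \<in> \<Theta>[regime b](\<lambda>a. \<tau> * (?l * gap b \<sigma> s a))"
    by (rule plus_smallo_bigtheta)
  also note T
  finally have E: "(\<lambda>a. fend (s b) a + \<tau> * (?l * gap b \<sigma> s a)) \<in> \<Theta>[regime b](\<lambda>a. ratio b a ^ Suc k)" .
  have D: "(\<lambda>a. fdst (s b) a + ?l * gap b \<sigma> s a) \<in> O[regime b](\<lambda>a. ratio b a ^ Suc k)"
    by (intro add_cmult_in_bigo G' O') (auto simp: comps_def)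
  have "dominant b (Suc k) (fmove \<omega> b \<sigma> \<tau> s)"
    unfolding dominant_def comps_ball
  proof (intro conjI allI)
    show "fend (fmove \<omega> b \<sigma> \<tau> s b) \<in> \<Theta>[regime b](\<lambda>a. ratio b a ^ Suc k)"
      using E by (simp add: fmove_def)
  qed (use bigthetaD1[OF E] D in \<open>auto simp: fmove_def comps_def simp del: power_Suc intro!: O'\<close>)
  then show ?thesis ..
qed

text \<open>The move leaves \<open>fend (s b)\<close> alone, and by \<open>gap_bigo_other\<close>
  its new components have order at most \<open>k\<close>.\<close>

lemma fmove_dominant_other:
  assumes "dominant b k s"
  shows "dominant b k (fmove \<omega> (\<not> b) \<sigma> \<tau> s)"
proof -
  have O: "g \<in> O[regime b](\<lambda>a. ratio b a ^ k)" if "g \<in> comps s" for g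
    using assms that by (simp add: dominant_def)
  note G = gap_bigo_other[OF assms]
  have "(\<lambda>a. f a + c * gap (\<not> b) \<sigma> s a) \<in> O[regime b](\<lambda>a. ratio b a ^ k)" if "f \<in> comps s" for f c
    using O[OF that] G by (rule add_cmult_in_bigo)
  \<comment> \<open>The second instance has the coefficient \<open>\<tau> * _\<close>, reassociated
    to match the shape of \<open>fend\<close> in \<open>fmove\<close>.\<close>
  note P = this this[of _ "\<tau> * _", simplified mult.assoc]
  show ?thesis
    using assms by (auto simp: dominant_def comps_ball fmove_def intro!: P) (auto simp: comps_def)
qed

lemma fmove_admissible:
  assumes "admissible s" "\<sigma> \<noteq> 0" "\<tau> \<noteq> 0"
  shows "admissible (fmove \<omega> b \<sigma> \<tau> s)"
  unfolding admissible_def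
proof (intro conjI allI)
  have L: "\<forall>g\<in>comps s. laurent g" using assms by (simp add: admissible_def)
  show "\<forall>g\<in>comps (fmove \<omega> b \<sigma> \<tau> s). laurent g"
    using L gap_laurent[OF L, of b \<sigma>] unfolding comps_ball
    by (auto simp: fmove_def intro!: laurent_add laurent_mult)
  fix c
  show "\<exists>k. dominant c k (fmove \<omega> b \<sigma> \<tau> s)"
  proof (cases "c = b")
    case True
    then show ?thesis using assms fmove_dominant_same unfolding admissible_def by blast
  next
    case False
    then have "b = (\<not> c)" by simp
    then show ?thesis using assms fmove_dominant_other unfolding admissible_def by blast
  qed
qed

text \<open>An exact order of growth makes the gap eventually nonzero along a nontrivial filter. A
  single positive point where it is nonzero suffices for a Laurent polynomial.\<close>

lemma gap_finite_zeros:
  assumes "admissible s" "\<sigma> \<noteq> 0"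
  shows "finite {a. a > 0 \<and> gap b \<sigma> s a = 0}"
proof -
  from assms obtain k where "dominant b k s" by (auto simp: admissible_def)
  from gap_bigtheta[OF this assms(2)]
  have "(\<lambda>a. ratio b a ^ Suc k) \<in> O[regime b](gap b \<sigma> s)" by (simp add: bigtheta_def bigomega_iff_bigo)
  then obtain c where "eventually (\<lambda>a. norm (ratio b a ^ Suc k) \<le> c * norm (gap b \<sigma> s a)) (regime b)"
    by (elim landau_o.bigE)
  with regime_pos[of b] have "eventually (\<lambda>a. a > 0 \<and> gap b \<sigma> s a \<noteq> 0) (regime b)"
  proof eventually_elim
    case (elim a)
    then have "ratio b a ^ Suc k > 0" by (simp add: ratio_def speed_pos del: power_Suc)
    with elim show ?case by (auto simp del: power_Suc)
  qed
  with regime_nontrivial obtain a where "a > 0" "gap b \<sigma> s a \<noteq> 0"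
    using eventually_happens by blast
  then show ?thesis using laurent_finite_zeros gap_laurent assms by (auto simp: admissible_def)
qed

subsection \<open>From formal states to runs\<close>

definition rob :: "bool \<Rightarrow> rstate \<times> rstate \<Rightarrow> rstate" where
  "rob b st = (if b then fst st else snd st)"

text \<open>By the second conjunct no move starts after the other robot's move ends, so whoever
  looks next does so during the other's current move.\<close>

definition consistent :: "real \<Rightarrow> rstate \<times> rstate \<Rightarrow> bool" where
  "consistent \<alpha> st \<longleftrightarrow> (\<forall>b. tend (rob b st) =
       tstart (rob b st) + \<bar>dst (rob b st) - src (rob b st)\<bar> / speed b \<alpha>) \<and>
     (\<forall>b c. tstart (rob b st) \<le> tend (rob c st))"

text \<open>The field \<open>stopped = False\<close> is included, so a run that realizes formal
  states at all steps never gathers.\<close>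

definition realizes :: "real \<Rightarrow> fstate \<Rightarrow> rstate \<times> rstate \<Rightarrow> bool" where
  "realizes \<alpha> s st \<longleftrightarrow> (\<forall>b. rob b st =
     \<lparr>src = fsrc (s b) \<alpha>, dst = fdst (s b) \<alpha>, tstart = fbeg (s b) \<alpha> / speed b \<alpha>,
      tend = fend (s b) \<alpha> / speed b \<alpha>, cnt = fcnt (s b), stopped = False\<rparr>)"

lemma pos_at_moving:
  assumes "v > 0" "\<not> stopped r" "tend r = tstart r + \<bar>dst r - src r\<bar> / v"
    and "tstart r \<le> t" "t \<le> tend r"
  obtains \<sigma> where "\<sigma> \<in> {1, -1}" "pos_at r t = src r + \<sigma> * (v * (t - tstart r))"
proof -
  define \<sigma> :: real where "\<sigma> = (if dst r \<ge> src r then 1 else -1)"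
  have d: "dst r - src r = \<sigma> * (v * (tend r - tstart r))"
    using assms by (simp add: \<sigma>_def)
  have "pos_at r t = src r + \<sigma> * (v * (t - tstart r))"
  \<comment> \<open>In the first case \<open>t\<close> is the arrival time, so the value
    \<open>dst r\<close> agrees with the linear formula, also for a move of length zero.\<close>
  proof (cases "tend r \<le> tstart r \<or> tend r \<le> t")
    case True
    then have "tend r = t" using assms by auto
    with True d show ?thesis by (simp add: pos_at_def)
  next
    case False
    then show ?thesis using assms(2) by (simp add: pos_at_def d)
  qed
  moreover have "\<sigma> \<in> {1, -1}" by (simp add: \<sigma>_def)
  ultimately show ?thesis using that by blast
qed

text \<open>Hides the tie-breaking of \<open>gstep\<close> in favour of robot 1, so that both robots
  can be treated alike afterwards.\<close>

lemma gstep_cases: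
  assumes "\<And>b. \<not> stopped (rob b st)"
  obtains b where "tend (rob b st) \<le> tend (rob (\<not> b) st)"
    "rob b (gstep \<alpha> \<omega> st) = look_move (speed b \<alpha>) (\<lambda>k. \<omega> (b, k)) (rob b st) (rob (\<not> b) st)"
    "rob (\<not> b) (gstep \<alpha> \<omega> st) = rob (\<not> b) st"
proof -
  obtain r1 r2 where st: "st = (r1, r2)" by force
  have ns: "\<not> stopped r1" "\<not> stopped r2"
    using assms[of True] assms[of False] by (simp_all add: rob_def st)
  show ?thesis
  proof (cases "tend r1 \<le> tend r2")
    case True
    then show ?thesis using ns by (intro that[of True]) (simp_all add: rob_def st gstep_def speed_def)
  next
    case False
    then show ?thesis using ns by (intro that[of False]) (simp_all add: rob_def st gstep_def speed_def)
  qed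
qed

text \<open>The true directions of motion supply \<open>\<sigma>\<close> and \<open>\<tau>\<close>,
  and the nonzero gap rules out the stopping branch of \<open>look_move\<close>.\<close>

lemma gstep_realizes:
  assumes "\<alpha> > 0" "realizes \<alpha> s st" "consistent \<alpha> st"
    and gap: "\<And>b \<sigma>. \<sigma> \<in> {1, -1} \<Longrightarrow> gap b \<sigma> s \<alpha> \<noteq> 0"
  shows "\<exists>b. \<exists>\<sigma>\<in>{1, -1}. \<exists>\<tau>\<in>{1, -1}.
    realizes \<alpha> (fmove \<omega> b \<sigma> \<tau> s) (gstep \<alpha> \<omega> st) \<and> consistent \<alpha> (gstep \<alpha> \<omega> st)"
proof -
  have R: "rob b st =
     \<lparr>src = fsrc (s b) \<alpha>, dst = fdst (s b) \<alpha>, tstart = fbeg (s b) \<alpha> / speed b \<alpha>,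
      tend = fend (s b) \<alpha> / speed b \<alpha>, cnt = fcnt (s b), stopped = False\<rparr>" for b
    using assms(2) by (simp add: realizes_def)
  then have ns: "\<not> stopped (rob b st)" for b by simp
  obtain b where b: "tend (rob b st) \<le> tend (rob (\<not> b) st)"
    "rob b (gstep \<alpha> \<omega> st) = look_move (speed b \<alpha>) (\<lambda>k. \<omega> (b, k)) (rob b st) (rob (\<not> b) st)"
    "rob (\<not> b) (gstep \<alpha> \<omega> st) = rob (\<not> b) st"
    using gstep_cases[OF ns] by metis
  have v: "speed c \<alpha> > 0" for c using assms(1) by (rule speed_pos)
  have cons: "tend (rob c st) = tstart (rob c st) + \<bar>dst (rob c st) - src (rob c st)\<bar> / speed c \<alpha>"
    "tstart (rob c st) \<le> tend (rob d st)" for c d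
    using assms(3) by (auto simp: consistent_def)
  obtain \<sigma> where \<sigma>: "\<sigma> \<in> {1, -1}" "pos_at (rob (\<not> b) st) (tend (rob b st)) =
      src (rob (\<not> b) st) + \<sigma> * (speed (\<not> b) \<alpha> * (tend (rob b st) - tstart (rob (\<not> b) st)))"
    by (rule pos_at_moving[OF v ns cons(1) cons(2) b(1)])
  define g where "g = gap b \<sigma> s \<alpha>"
  define l where "l = \<omega> (b, fcnt (s b))"
  \<comment> \<open>For a zero displacement the sign is set to 1 rather than 0, since admissibility
    is preserved only for nonzero signs.\<close>
  define \<tau> :: real where "\<tau> = (if l * g \<ge> 0 then 1 else -1)"
  have abs: "\<bar>l * g\<bar> = \<tau> * (l * g)" by (simp add: \<tau>_def)
  \<comment> \<open>When robot \<open>b\<close> looks, the other one has travelled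
    \<open>ratio b \<alpha> * fend (s b) \<alpha>\<close> in total; subtracting \<open>fbeg\<close>
    leaves its progress within the current move.\<close>
  have pos: "pos_at (rob (\<not> b) st) (tend (rob b st)) = fdst (s b) \<alpha> + g"
    unfolding \<sigma>(2) using v[of b] v[of "\<not> b"]
    by (simp add: R g_def gap_def ratio_def field_simps)
  have "g \<noteq> 0" using gap \<sigma>(1) by (simp add: g_def)
  then have new: "rob b (gstep \<alpha> \<omega> st) =
    \<lparr>src = fdst (s b) \<alpha>, dst = fdst (s b) \<alpha> + l * g, tstart = fend (s b) \<alpha> / speed b \<alpha>,
     tend = fend (s b) \<alpha> / speed b \<alpha> + \<bar>l * g\<bar> / speed b \<alpha>, cnt = Suc (fcnt (s b)), stopped = False\<rparr>"
    unfolding b(2) look_move_def Let_def pos by (simp add: R l_def)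
  have all_bool: "(\<forall>c. P c) \<longleftrightarrow> P b \<and> P (\<not> b)" for P
    by (cases b) (auto simp: all_bool_eq)
  have "realizes \<alpha> (fmove \<omega> b \<sigma> \<tau> s) (gstep \<alpha> \<omega> st)"
    unfolding realizes_def all_bool new b(3) abs
    by (simp add: fmove_def R g_def l_def add_divide_distrib)
  moreover have "consistent \<alpha> (gstep \<alpha> \<omega> st)"
  proof -
    have t: "tstart (rob b (gstep \<alpha> \<omega> st)) = tend (rob b st)"
      "tend (rob b (gstep \<alpha> \<omega> st)) = tend (rob b st) + \<bar>l * g\<bar> / speed b \<alpha>"
      by (simp_all add: new R)
    have "\<bar>l * g\<bar> / speed b \<alpha> \<ge> 0" using v[of b] by simp
    then have "tend (rob b st) \<le> tend (rob b (gstep \<alpha> \<omega> st))" by (simp add: t)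
    moreover have "tend (rob b (gstep \<alpha> \<omega> st)) = tstart (rob b (gstep \<alpha> \<omega> st)) +
        \<bar>dst (rob b (gstep \<alpha> \<omega> st)) - src (rob b (gstep \<alpha> \<omega> st))\<bar> / speed b \<alpha>"
      by (simp add: new)
    \<comment> \<open>The new move starts at the old \<open>tend\<close> of robot \<open>b\<close>,
      which is at most that of the other robot; the other's \<open>tstart\<close> is at most this
      old \<open>tend\<close>, hence at most the new one.\<close>
    ultimately show ?thesis
      using cons b(1) order_trans[OF cons(2)] unfolding consistent_def all_bool b(3) t(1) by blast
  qed
  ultimately show ?thesis using \<sigma>(1) by (intro exI[of _ b] bexI[of _ \<sigma>] bexI[of _ \<tau>]) (auto simp: \<tau>_def)
qed

section \<open>Countably many exceptional speed ratios\<close>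

fun reachable :: "(bool \<times> nat \<Rightarrow> real) \<Rightarrow> fstate \<Rightarrow> nat \<Rightarrow> fstate set" where
  "reachable \<omega> s 0 = {s}"
| "reachable \<omega> s (Suc n) =
     (\<lambda>(r, b, \<sigma>, \<tau>). fmove \<omega> b \<sigma> \<tau> r) ` (reachable \<omega> s n \<times> UNIV \<times> {1, -1} \<times> {1, -1})"

lemma reachable_finite: "finite (reachable \<omega> s n)"
  by (induction n) auto

lemma reachable_admissible:
  "admissible s \<Longrightarrow> r \<in> reachable \<omega> s n \<Longrightarrow> admissible r"
  by (induction n arbitrary: r) (auto intro!: fmove_admissible)

text \<open>Contains every positive ratio at which some observation might find distance zero. The
  formal states do not depend on the ratio, so this is a countable union of finite sets.\<close>

definition exceptional :: "(bool \<times> nat \<Rightarrow> real) \<Rightarrow> fstate \<Rightarrow> real set" where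
  "exceptional \<omega> s = (\<Union>n. \<Union>r\<in>reachable \<omega> s n. \<Union>b. \<Union>\<sigma>\<in>{1, -1}. {a. a > 0 \<and> gap b \<sigma> r a = 0})"

lemma exceptional_countable: "admissible s \<Longrightarrow> countable (exceptional \<omega> s)"
  unfolding exceptional_def
  by (intro countable_UN countable_finite[OF gap_finite_zeros] countable_finite[OF reachable_finite])
    (auto intro: reachable_admissible)

lemma run_realizes:
  assumes "\<alpha> > 0" "\<alpha> \<notin> exceptional \<omega> s" "realizes \<alpha> s st" "consistent \<alpha> st"
  shows "\<exists>r\<in>reachable \<omega> s n. realizes \<alpha> r ((gstep \<alpha> \<omega> ^^ n) st) \<and> consistent \<alpha> ((gstep \<alpha> \<omega> ^^ n) st)"
proof (induction n)
  case 0
  then show ?case using assms by simp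
next
  case (Suc n)
  then obtain r where r: "r \<in> reachable \<omega> s n" "realizes \<alpha> r ((gstep \<alpha> \<omega> ^^ n) st)"
    "consistent \<alpha> ((gstep \<alpha> \<omega> ^^ n) st)" by blast
  have "gap b \<sigma> r \<alpha> \<noteq> 0" if "\<sigma> \<in> {1, -1}" for b \<sigma>
    using assms(1,2) r(1) that unfolding exceptional_def by blast
  from gstep_realizes[OF assms(1) r(2,3) this, of \<omega>] obtain b \<sigma> \<tau> where *:
    "\<sigma> \<in> {1, -1}" "\<tau> \<in> {1, -1}" "realizes \<alpha> (fmove \<omega> b \<sigma> \<tau> r) (gstep \<alpha> \<omega> ((gstep \<alpha> \<omega> ^^ n) st))"
    "consistent \<alpha> (gstep \<alpha> \<omega> ((gstep \<alpha> \<omega> ^^ n) st))" by blast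
  have "fmove \<omega> b \<sigma> \<tau> r \<in> reachable \<omega> s (Suc n)"
    using * r(1) by (auto intro!: image_eqI[where x="(r, b, \<sigma>, \<tau>)"])
  with * show ?case unfolding funpow.simps o_apply by blast
qed

section \<open>The run up to the first nonzero moves\<close>

lemma run_0: "run \<alpha> p q \<omega> 0 = (init_state p, init_state q)"
  by (simp add: run_def)

lemma run_Suc: "run \<alpha> p q \<omega> (Suc n) = gstep \<alpha> \<omega> (run \<alpha> p q \<omega> n)"
  by (simp add: run_def)

lemma run_add: "run \<alpha> p q \<omega> (m + n) = (gstep \<alpha> \<omega> ^^ n) (run \<alpha> p q \<omega> m)"
  by (induction n) (simp_all add: run_Suc)

text \<open>A gathered state is a fixed point of \<open>gstep\<close>, so any initial segment of the
  run may be discarded.\<close>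

lemma gathers_later:
  assumes "gathers \<alpha> p q \<omega>"
  shows "\<exists>n. \<forall>b. stopped (rob b ((gstep \<alpha> \<omega> ^^ n) (run \<alpha> p q \<omega> N)))"
proof -
  from assms obtain m where m: "stopped (fst (run \<alpha> p q \<omega> m))" "stopped (snd (run \<alpha> p q \<omega> m))"
    by (auto simp: gathers_def)
  have "(gstep \<alpha> \<omega> ^^ k) (run \<alpha> p q \<omega> m) = run \<alpha> p q \<omega> m" for k
    by (induction k) (use m in \<open>auto simp: gstep_def split: prod.splits\<close>)
  then have "run \<alpha> p q \<omega> (N + m) = run \<alpha> p q \<omega> m"
    by (metis run_add add.commute)
  then show ?thesis using m by (intro exI[of _ m]) (simp add: run_add[symmetric] rob_def)
qed

text \<open>A zero choice gives a move of no duration. The clock stays at 0, and the tie keeps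
  letting robot 1 look.\<close>

lemma run_before_first_move:
  "\<forall>k<n. \<omega> (True, k) = 0 \<Longrightarrow>
   run \<alpha> 0 1 \<omega> n = ((init_state 0)\<lparr>cnt := n\<rparr>, init_state 1)"
  by (induction n) (auto simp: run_0 run_Suc init_state_def gstep_def look_move_def pos_at_def)

lemma run_first_move:
  assumes "\<forall>k<m. \<omega> (True, k) = 0" "\<omega> (True, m) = l" "l \<noteq> 0"
    and "\<forall>k<n. \<omega> (False, k) = 0"
  shows "run \<alpha> 0 1 \<omega> (Suc m + n) =
   (\<lparr>src = 0, dst = l, tstart = 0, tend = \<bar>l\<bar>, cnt = Suc m, stopped = False\<rparr>,
    (init_state 1)\<lparr>cnt := n\<rparr>)"
  using assms(4)
proof (induction n)
  case 0
  then show ?case using assms(2) run_before_first_move[OF assms(1)]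
    by (simp add: run_Suc init_state_def gstep_def look_move_def pos_at_def)
next
  case (Suc n)
  then have "\<omega> (False, n) = 0" by simp
  with Suc show ?case using assms(3)
    by (simp add: run_Suc init_state_def gstep_def look_move_def pos_at_def)
qed

text \<open>Robot 2 still looks at time 0, when robot 1 is at 0, so it observes the signed distance
  -1 and its displacement is \<open>- l'\<close>.\<close>

lemma run_second_move:
  assumes "\<forall>k<m. \<omega> (True, k) = 0" "\<omega> (True, m) = l" "l \<noteq> 0"
    and "\<forall>k<n. \<omega> (False, k) = 0" "\<omega> (False, n) = l'"
  shows "run \<alpha> 0 1 \<omega> (Suc (Suc m + n)) =
   (\<lparr>src = 0, dst = l, tstart = 0, tend = \<bar>l\<bar>, cnt = Suc m, stopped = False\<rparr>,
    \<lparr>src = 1, dst = 1 - l', tstart = 0, tend = \<bar>l'\<bar> / \<alpha>, cnt = Suc n, stopped = False\<rparr>)"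
  unfolding run_Suc[of _ _ _ _ "Suc m + n"] run_first_move[OF assms(1-4)]
  using assms(3,5) by (simp add: init_state_def gstep_def look_move_def pos_at_def)

text \<open>The state after both first nonzero moves have been chosen. The induction starts here
  because initially the travelled distances are zero and no order is dominant.\<close>

definition start :: "nat \<Rightarrow> real \<Rightarrow> nat \<Rightarrow> real \<Rightarrow> fstate" where
  "start m l n l' b = (if b
     then \<lparr>fsrc = \<lambda>_. 0, fdst = \<lambda>_. l, fbeg = \<lambda>_. 0, fend = \<lambda>_. \<bar>l\<bar>, fcnt = Suc m\<rparr>
     else \<lparr>fsrc = \<lambda>_. 1, fdst = \<lambda>_. 1 - l', fbeg = \<lambda>_. 0, fend = \<lambda>_. \<bar>l'\<bar>, fcnt = Suc n\<rparr>)"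

lemma start_admissible:
  assumes "l \<noteq> 0" "l' \<noteq> 0"
  shows "admissible (start m l n l')"
proof -
  have "dominant b 0 (start m l n l')" for b
    using assms by (auto simp: dominant_def comps_ball start_def)
  then show ?thesis by (auto simp: admissible_def comps_ball start_def)
qed

lemma gathering_ratios_countable: "countable {\<alpha>. \<alpha> > 0 \<and> gathers \<alpha> 0 1 \<omega>}"
proof (cases "(\<exists>k. \<omega> (True, k) \<noteq> 0) \<and> (\<exists>k. \<omega> (False, k) \<noteq> 0)")
  case True
  define m where "m = (LEAST k. \<omega> (True, k) \<noteq> 0)"
  define n where "n = (LEAST k. \<omega> (False, k) \<noteq> 0)"
  have l: "\<omega> (True, m) \<noteq> 0" "\<omega> (False, n) \<noteq> 0"
    using True unfolding m_def n_def by (metis (mono_tags, lifting) LeastI)+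
  have z: "\<forall>k<m. \<omega> (True, k) = 0" "\<forall>k<n. \<omega> (False, k) = 0"
    unfolding m_def n_def using not_less_Least by blast+
  define s where "s = start m (\<omega> (True, m)) n (\<omega> (False, n))"
  note run = run_second_move[OF z(1) refl l(1) z(2) refl]
  have "\<alpha> \<in> exceptional \<omega> s" if "\<alpha> > 0" "gathers \<alpha> 0 1 \<omega>" for \<alpha>
  proof (rule ccontr)
    assume ne: "\<alpha> \<notin> exceptional \<omega> s"
    have "realizes \<alpha> s (run \<alpha> 0 1 \<omega> (Suc (Suc m + n)))"
      unfolding run by (auto simp: realizes_def rob_def s_def start_def speed_def)
    moreover have "consistent \<alpha> (run \<alpha> 0 1 \<omega> (Suc (Suc m + n)))"
      unfolding run using \<open>\<alpha> > 0\<close> by (auto simp: consistent_def rob_def speed_def)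
    ultimately obtain r where
      "realizes \<alpha> (r k) ((gstep \<alpha> \<omega> ^^ k) (run \<alpha> 0 1 \<omega> (Suc (Suc m + n))))" for k
      using run_realizes[OF \<open>\<alpha> > 0\<close> ne] by metis
    then have "\<not> stopped (rob b ((gstep \<alpha> \<omega> ^^ k) (run \<alpha> 0 1 \<omega> (Suc (Suc m + n)))))" for k b
      unfolding realizes_def by simp
    with gathers_later[OF that(2)] show False by blast
  qed
  then have "{\<alpha>. \<alpha> > 0 \<and> gathers \<alpha> 0 1 \<omega>} \<subseteq> exceptional \<omega> s" by blast
  moreover have "countable (exceptional \<omega> s)"
    unfolding s_def by (intro exceptional_countable start_admissible l)
  ultimately show ?thesis by (rule countable_subset)
next
  case False
  \<comment> \<open>A robot all of whose choices are zero repeats moves of no duration at time 0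
    forever, and nobody ever stops.\<close>
  have "\<not> gathers \<alpha> 0 1 \<omega>" for \<alpha>
  proof (cases "\<exists>k. \<omega> (True, k) \<noteq> 0")
    case ex: True
    define m where "m = (LEAST k. \<omega> (True, k) \<noteq> 0)"
    have "\<omega> (True, m) \<noteq> 0" using ex unfolding m_def by (metis (mono_tags, lifting) LeastI)
    moreover have "\<forall>k<m. \<omega> (True, k) = 0"
      unfolding m_def using not_less_Least by blast
    ultimately have "run \<alpha> 0 1 \<omega> (Suc m + n) =
      (\<lparr>src = 0, dst = \<omega> (True, m), tstart = 0, tend = \<bar>\<omega> (True, m)\<bar>, cnt = Suc m, stopped = False\<rparr>,
       (init_state 1)\<lparr>cnt := n\<rparr>)" for n
      using False ex by (intro run_first_move) auto
    then have "\<not> stopped (rob True ((gstep \<alpha> \<omega> ^^ n) (run \<alpha> 0 1 \<omega> (Suc m))))" for n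
      unfolding run_add[symmetric] by (simp add: rob_def)
    then show ?thesis using gathers_later by blast
  next
    case False
    then show ?thesis using run_before_first_move[of _ \<omega>]
      by (auto simp: gathers_def init_state_def)
  qed
  then show ?thesis by simp
qed

subsection \<open>Invariance under similarities\<close>

text \<open>A negative \<open>d\<close> reflects the line. Times scale by
  \<open>\<bar>d\<bar>\<close> because the speeds are kept.\<close>

definition similarity :: "real \<Rightarrow> real \<Rightarrow> rstate \<Rightarrow> rstate" where
  "similarity p d r = \<lparr>src = p + d * src r, dst = p + d * dst r, tstart = \<bar>d\<bar> * tstart r,
     tend = \<bar>d\<bar> * tend r, cnt = cnt r, stopped = stopped r\<rparr>"

lemma pos_at_similarity:
  assumes "d \<noteq> 0"
  shows "pos_at (similarity p d r) (\<bar>d\<bar> * t) = p + d * pos_at r t"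
proof -
  have "(\<bar>d\<bar> * t - \<bar>d\<bar> * a) / (\<bar>d\<bar> * b - \<bar>d\<bar> * a) = (t - a) / (b - a)" for a b
    using assms by (simp only: right_diff_distrib[symmetric]) simp
  then show ?thesis
    using assms by (simp add: pos_at_def similarity_def) (simp add: algebra_simps)
qed

lemma look_move_similarity:
  assumes "d \<noteq> 0"
  shows "look_move v L (similarity p d r) (similarity p d r') = similarity p d (look_move v L r r')"
proof -
  have t: "tend (similarity p d r) = \<bar>d\<bar> * tend r" "dst (similarity p d r) = p + d * dst r"
    "cnt (similarity p d r) = cnt r"
    by (simp_all add: similarity_def)
  have e: "p + d * x + l * (p + d * y - (p + d * x)) = p + d * (x + l * (y - x))" for l x y
    by (simp add: algebra_simps)
  have "p + d * x - (p + d * y) = d * (x - y)" for x y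
    by (simp add: algebra_simps)
  then have a: "\<bar>p + d * x - (p + d * y)\<bar> / v = \<bar>d\<bar> * (\<bar>x - y\<bar> / v)" for x y
    by (simp add: abs_mult)
  have s: "p + d * x = p + d * y \<longleftrightarrow> x = y" for x y
    using assms by simp
  show ?thesis
    unfolding look_move_def Let_def t pos_at_similarity[OF assms] e a s distrib_left[symmetric]
    by (simp add: similarity_def)
qed

lemma gstep_similarity:
  assumes "d \<noteq> 0"
  shows "gstep \<alpha> \<omega> (map_prod (similarity p d) (similarity p d) st) = map_prod (similarity p d) (similarity p d) (gstep \<alpha> \<omega> st)"
proof -
  have "stopped (similarity p d r) = stopped r" "tend (similarity p d r) \<le> tend (similarity p d r') \<longleftrightarrow> tend r \<le> tend r'"
    for r r' using assms by (simp_all add: similarity_def)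
  then show ?thesis
    by (cases st) (simp add: gstep_def look_move_similarity[OF assms])
qed

lemma run_similarity:
  assumes "p \<noteq> q"
  shows "run \<alpha> p q \<omega> n = map_prod (similarity p (q - p)) (similarity p (q - p)) (run \<alpha> 0 1 \<omega> n)"
proof (induction n)
  case 0
  then show ?case by (simp add: run_def init_state_def similarity_def)
next
  case (Suc n)
  have "q - p \<noteq> 0" using assms by simp
  with Suc show ?case by (simp add: run_def gstep_similarity)
qed

lemma gathers_similarity:
  assumes "p \<noteq> q"
  shows "gathers \<alpha> p q \<omega> \<longleftrightarrow> gathers \<alpha> 0 1 \<omega>"
  unfolding gathers_def run_similarity[OF assms] by (simp add: similarity_def)

subsection \<open>Measurability and conclusion\<close>

text \<open>Measurability is required field by field, which avoids a sigma-algebra on the record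
  type.\<close>

definition measurable_state :: "'x measure \<Rightarrow> ('x \<Rightarrow> rstate) \<Rightarrow> bool" where
  "measurable_state M r \<longleftrightarrow> (\<lambda>x. src (r x)) \<in> borel_measurable M \<and> (\<lambda>x. dst (r x)) \<in> borel_measurable M \<and>
     (\<lambda>x. tstart (r x)) \<in> borel_measurable M \<and> (\<lambda>x. tend (r x)) \<in> borel_measurable M \<and>
     (\<lambda>x. cnt (r x)) \<in> measurable M (count_space UNIV) \<and> Measurable.pred M (\<lambda>x. stopped (r x))"

lemma measurable_stateD:
  assumes "measurable_state M r"
  shows "(\<lambda>x. src (r x)) \<in> borel_measurable M" "(\<lambda>x. dst (r x)) \<in> borel_measurable M"
     "(\<lambda>x. tstart (r x)) \<in> borel_measurable M" "(\<lambda>x. tend (r x)) \<in> borel_measurable M"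
     "(\<lambda>x. cnt (r x)) \<in> measurable M (count_space UNIV)" "Measurable.pred M (\<lambda>x. stopped (r x))"
  using assms by (simp_all add: measurable_state_def)

lemma measurable_state_If:
  assumes "measurable_state M r" "measurable_state M r'" "Measurable.pred M P"
  shows "measurable_state M (\<lambda>x. if P x then r x else r' x)"
proof -
  note [measurable] = measurable_stateD[OF assms(1)] measurable_stateD[OF assms(2)] assms(3)
  show ?thesis
    unfolding measurable_state_def if_distrib[of src] if_distrib[of dst] if_distrib[of tstart]
      if_distrib[of tend] if_distrib[of cnt] if_distrib[of stopped]
    by (intro conjI; measurable)
qed

lemma measurable_pos_at:
  assumes "measurable_state M r" and [measurable]: "t \<in> borel_measurable M"
  shows "(\<lambda>x. pos_at (r x) (t x)) \<in> borel_measurable M"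
proof -
  note [measurable] = measurable_stateD[OF assms(1)]
  show ?thesis unfolding pos_at_def by measurable
qed

lemma measurable_look_move:
  assumes "measurable_state M r" "measurable_state M r'" and [measurable]: "v \<in> borel_measurable M"
    and L [measurable]: "\<And>k. (\<lambda>x. L x k) \<in> borel_measurable M"
  shows "measurable_state M (\<lambda>x. look_move (v x) (L x) (r x) (r' x))"
proof -
  note [measurable] = measurable_stateD[OF assms(1)] measurable_stateD[OF assms(2)]
  have [measurable]: "(\<lambda>x. pos_at (r' x) (tend (r x))) \<in> borel_measurable M"
    by (rule measurable_pos_at[OF assms(2)]) measurable
  \<comment> \<open>The index of the random choice is itself random, but it takes only countably
    many values.\<close>
  have [measurable]: "(\<lambda>x. L x (cnt (r x))) \<in> borel_measurable M"
    by (rule measurable_compose_countable[of "\<lambda>i x. L x i"]) measurable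
  show ?thesis unfolding look_move_def Let_def
  proof (rule measurable_state_If)
    show "measurable_state M (\<lambda>x. r x\<lparr>src := dst (r x), stopped := True\<rparr>)"
      by (simp add: measurable_state_def)
    show "measurable_state M (\<lambda>x. \<lparr>src = dst (r x),
        dst = dst (r x) + L x (cnt (r x)) * (pos_at (r' x) (tend (r x)) - dst (r x)), tstart = tend (r x),
        tend = tend (r x) + \<bar>dst (r x) + L x (cnt (r x)) * (pos_at (r' x) (tend (r x)) - dst (r x)) - dst (r x)\<bar> / v x,
        cnt = Suc (cnt (r x)), stopped = False\<rparr>)"
      unfolding measurable_state_def rstate.simps by (intro conjI; measurable)
  qed measurable
qed

text \<open>The speed ratio and the choices both depend on \<open>x\<close>, so the result applies
  to the product space on which Fubini is used.\<close>

lemma measurable_run: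
  assumes [measurable]: "a \<in> borel_measurable M" and [measurable]: "\<And>i. (\<lambda>x. w x i) \<in> borel_measurable M"
  shows "measurable_state M (\<lambda>x. fst (run (a x) p q (w x) n)) \<and> measurable_state M (\<lambda>x. snd (run (a x) p q (w x) n))"
proof (induction n)
  case 0
  then show ?case by (simp add: run_def measurable_state_def)
next
  case (Suc n)
  define r1 r2 where "r1 x = fst (run (a x) p q (w x) n)" and "r2 x = snd (run (a x) p q (w x) n)" for x
  have r: "measurable_state M r1" "measurable_state M r2"
    using Suc by (simp_all add: r1_def[abs_def] r2_def[abs_def])
  note [measurable] = measurable_stateD[OF r(1)] measurable_stateD[OF r(2)]
  have l: "measurable_state M (\<lambda>x. look_move 1 (\<lambda>k. w x (True, k)) (r1 x) (r2 x))"
    "measurable_state M (\<lambda>x. look_move (a x) (\<lambda>k. w x (False, k)) (r2 x) (r1 x))"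
    by (rule measurable_look_move[OF r(1) r(2)] measurable_look_move[OF r(2) r(1)],
        simp_all add: assms)+
  have "run (a x) p q (w x) (Suc n) = gstep (a x) (w x) (r1 x, r2 x)" for x
    by (simp add: run_def r1_def r2_def)
  then have eq: "fst (run (a x) p q (w x) (Suc n)) =
       (if stopped (r1 x) \<and> stopped (r2 x) then r1 x
        else if \<not> stopped (r1 x) \<and> (stopped (r2 x) \<or> tend (r1 x) \<le> tend (r2 x))
        then look_move 1 (\<lambda>k. w x (True, k)) (r1 x) (r2 x) else r1 x)"
    "snd (run (a x) p q (w x) (Suc n)) =
       (if stopped (r1 x) \<and> stopped (r2 x) then r2 x
        else if \<not> stopped (r1 x) \<and> (stopped (r2 x) \<or> tend (r1 x) \<le> tend (r2 x))
        then r2 x else look_move (a x) (\<lambda>k. w x (False, k)) (r2 x) (r1 x))" for x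
    by (simp_all add: gstep_def)
  have P: "Measurable.pred M (\<lambda>x. stopped (r1 x) \<and> stopped (r2 x))"
    "Measurable.pred M (\<lambda>x. \<not> stopped (r1 x) \<and> (stopped (r2 x) \<or> tend (r1 x) \<le> tend (r2 x)))"
    by measurable
  show ?case unfolding eq by (intro conjI measurable_state_If r l P)
qed

lemma measurable_gathers:
  assumes "a \<in> borel_measurable M" and "\<And>i. (\<lambda>x. w x i) \<in> borel_measurable M"
  shows "Measurable.pred M (\<lambda>x. gathers (a x) p q (w x))"
proof -
  note F = measurable_stateD(6)[OF conjunct1[OF measurable_run[OF assms]]]
    measurable_stateD(6)[OF conjunct2[OF measurable_run[OF assms]]]
  show ?thesis unfolding gathers_def by (intro pred_intros_countable pred_intros_logic F)
qed

theorem theorem3: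
  fixes D :: "real measure"
  assumes "prob_space D" and "sets D = sets borel"
  shows "\<exists>\<alpha>>0. \<forall>p q :: real. p \<noteq> q \<longrightarrow>
           (AE \<omega> in outcomes D. \<not> gathers \<alpha> p q \<omega>)"
proof -
  interpret P: prob_space "outcomes D"
    unfolding outcomes_def by (rule prob_space_PiM) (rule assms(1))
  interpret pair_sigma_finite lborel "outcomes D" ..
  let ?M = "lborel \<Otimes>\<^sub>M outcomes D"
  have component: "(\<lambda>\<omega>. \<omega> i) \<in> borel_measurable (outcomes D)" for i
  proof -
    have "(\<lambda>\<omega>. \<omega> i) \<in> measurable (outcomes D) D"
      unfolding outcomes_def by (rule measurable_component_singleton) simp
    then show ?thesis by (simp add: measurable_cong_sets[OF refl assms(2)])
  qed
  have "Measurable.pred ?M (\<lambda>x. gathers (fst x) 0 1 (snd x))"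
    by (rule measurable_gathers) (auto intro: measurable_compose[OF measurable_snd component])
  then have "Measurable.pred ?M (\<lambda>x. 0 < fst x \<longrightarrow> \<not> gathers (fst x) 0 1 (snd x))"
    by measurable
  \<comment> \<open>For fixed choices the bad ratios are countable, hence Lebesgue null.\<close>
  moreover have "AE \<alpha> in lborel. 0 < \<alpha> \<longrightarrow> \<not> gathers \<alpha> 0 1 \<omega>" for \<omega>
    using AE_not_in[OF countable_imp_null_set_lborel[OF gathering_ratios_countable[of \<omega>]]] by simp
  \<comment> \<open>By joint measurability the two almost-everywhere quantifiers may be
    exchanged.\<close>
  ultimately have "AE \<alpha> in lborel. AE \<omega> in outcomes D. 0 < \<alpha> \<longrightarrow> \<not> gathers \<alpha> 0 1 \<omega>"
    by (subst AE_commute) (simp_all add: pred_def)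
  then have "AE \<alpha> in lborel. 0 < \<alpha> \<longrightarrow> (AE \<omega> in outcomes D. \<not> gathers \<alpha> 0 1 \<omega>)"
    by simp
  \<comment> \<open>The positive reals are not null, as they contain an interval of measure 1, so a
    positive ratio outside the null set exists.\<close>
  moreover have "\<not> (AE \<alpha> in lborel. \<not> 0 < (\<alpha> :: real))"
  proof
    assume "AE \<alpha> in lborel. \<not> 0 < (\<alpha> :: real)"
    then have "AE \<alpha> in lborel. \<alpha> \<notin> {0<..<1 :: real}" by eventually_elim simp
    then have "emeasure lborel {0<..<1 :: real} = 0"
      using AE_iff_measurable[of "{0<..<1 :: real}" lborel "\<lambda>\<alpha>. \<alpha> \<notin> {0<..<1}"]
      by (simp add: greaterThanLessThan_def greaterThan_def lessThan_def Int_def)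
    then show False by simp
  qed
  ultimately obtain \<alpha> where \<alpha>: "\<alpha> > 0" "AE \<omega> in outcomes D. \<not> gathers \<alpha> 0 1 \<omega>"
    by (metis (mono_tags, lifting) eventually_mono)
  show ?thesis
  proof (intro exI[of _ \<alpha>] conjI allI impI \<alpha>(1))
    fix p q :: real
    assume pq: "p \<noteq> q"
    \<comment> \<open>The ratio was found for the starting points 0 and 1; similarity invariance
      carries it to all distinct \<open>p\<close> and \<open>q\<close>.\<close>
    show "AE \<omega> in outcomes D. \<not> gathers \<alpha> p q \<omega>"
      unfolding gathers_similarity[OF pq] by (rule \<alpha>(2))
  qed
qed

end
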